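(* Let $b>\frac23$. Given any $f\in F_b$, there exist $T_{\lambda_0}>50$ and a one-parameter family of functions $\lambda_0\in\Lambda_b$ satisfying $$\frac{\lambda_0''(t)}{\lambda_0(t)}=\frac{f'(t)}{t},\qquad t\ge T_{\lambda_0},$$ and $$\lambda_0(t)>0,\qquad \frac{|\lambda_0'(t)|}{\lambda_0(t)}\le\frac{C}{t\log^b(t)},\qquad t\ge T_{\lambda_0}.$$
   Context: For $b>\frac23$, $F_b$ is the set of functions $f$ for which there exist $M>50$ and constants $C_{f,k}>0$ such that $f\in C^\infty([M,\infty))$ and $|f^{(k)}(t)|\le\frac{C_{f,k}}{t^k\log^b(t)}$ for all $t\ge M$ and $k\ge0$. For $b>\frac23$, $\Lambda_b$ is the set of functions $\lambda_0$ for which there exists $T_{\lambda_0}>50$ such that $\lambda_0\in C^\infty([T_{\lambda_0},\infty))$ and the following two conditions hold: (i) there exists $f\in F_b$ with $\frac{\lambda_0''(t)}{\lambda_0(t)}=\frac{f'(t)}{t}$ for $t\ge T_{\lambda_0}$; (ii) $\lambda_0(t)>0$ and $\frac{|\lambda_0'(t)|}{\lambda_0(t)}\le\frac{C}{t\log^b(t)}$ for $t\ge T_{\lambda_0}$. Here $C$ denotes some constant. *)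

theory Defs
  imports "HOL-Analysis.Analysis"
begin

text \<open>Derivatives are taken within the set \<open>S\<close>, so that on a half-line \<open>{M..}\<close> the
  derivative at the endpoint \<open>M\<close> is the right-hand one and values of the function to the
  left of \<open>M\<close> play no role.\<close>

primrec nderiv_on :: "real set \<Rightarrow> nat \<Rightarrow> (real \<Rightarrow> real) \<Rightarrow> real \<Rightarrow> real" where
  "nderiv_on S 0 f = f"
| "nderiv_on S (Suc k) f = (\<lambda>t. vector_derivative (nderiv_on S k f) (at t within S))"

definition C_infinity_on :: "real set \<Rightarrow> (real \<Rightarrow> real) \<Rightarrow> bool" where
  "C_infinity_on S f \<longleftrightarrow> (\<forall>k. nderiv_on S k f differentiable_on S)"

definition F_class :: "real \<Rightarrow> (real \<Rightarrow> real) set" where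
  "F_class b = {f. \<exists>M>50. C_infinity_on {M..} f \<and>
     (\<forall>k. \<exists>C>0. \<forall>t\<ge>M. \<bar>nderiv_on {M..} k f t\<bar> \<le> C / (t ^ k * ln t powr b))}"

text \<open>Functions are total in HOL, so that \<open>f\<close> is defined and smooth on \<open>{T..}\<close> (the paper's
  half-line \<open>[M, \<infinity>)\<close> contains \<open>T\<close>) has to be required explicitly for \<open>f'\<close> to be
  meaningful in the equation.\<close>

definition solves_ode_on :: "real \<Rightarrow> (real \<Rightarrow> real) \<Rightarrow> (real \<Rightarrow> real) \<Rightarrow> bool" where
  "solves_ode_on T f l \<longleftrightarrow> C_infinity_on {T..} f \<and>
     (\<forall>t\<ge>T. nderiv_on {T..} 2 l t / l t = nderiv_on {T..} 1 f t / t)"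

definition slow_positive_on :: "real \<Rightarrow> real \<Rightarrow> real \<Rightarrow> (real \<Rightarrow> real) \<Rightarrow> bool" where
  "slow_positive_on b C T l \<longleftrightarrow>
     (\<forall>t\<ge>T. l t > 0 \<and> \<bar>nderiv_on {T..} 1 l t\<bar> / l t \<le> C / (t * ln t powr b))"

definition Lambda_class :: "real \<Rightarrow> (real \<Rightarrow> real) set" where
  "Lambda_class b = {l. \<exists>T>50. C_infinity_on {T..} l \<and>
     (\<exists>f\<in>F_class b. solves_ode_on T f l) \<and> (\<exists>C. slow_positive_on b C T l)}"

text \<open>A family of functions on \<open>{T..}\<close>, indexed by a nonempty open real interval, depending
  continuously on the parameter, with distinct parameters giving functions that are distinct
  on \<open>{T..}\<close>.\<close>

definition one_parameter_family ::
    "real set \<Rightarrow> real \<Rightarrow> (real \<Rightarrow> real \<Rightarrow> real) \<Rightarrow> bool" where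
  "one_parameter_family I T lam \<longleftrightarrow>
     is_interval I \<and> open I \<and> I \<noteq> {} \<and>
     continuous_on (I \<times> {T..}) (\<lambda>(c, t). lam c t) \<and>
     (\<forall>c\<in>I. \<forall>d\<in>I. c \<noteq> d \<longrightarrow> (\<exists>t\<ge>T. lam c t \<noteq> lam d t))"

end

theory Submission
  imports Defs "HOL-Real_Asymp.Real_Asymp"
begin

text \<open>With \<open>q t = f' t / t\<close>, the logarithmic derivative \<open>u\<close> of a positive solution satisfies the
  Riccati equation \<open>u' = q - u\<^sup>2\<close>. The solution decaying at infinity is the one with
  \<open>u t = \<integral>\<^bsub>t\<^esub>\<^bsup>\<infinity>\<^esup> (u\<^sup>2 - q)\<close>, found by Banach's fixed point theorem among functions bounded by a
  multiple of \<open>1 / (t * ln t powr b)\<close>. Then \<open>exp (\<integral> u)\<close> solves the linear equation, and its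
  positive multiples are the one-parameter family. Smoothness comes for free: the algebra
  generated by \<open>1 / t\<close>, the derivatives of \<open>f\<close>, \<open>u\<close> and the solution is closed under
  differentiation.\<close>

section \<open>Smoothness on half-lines\<close>

lemma has_real_derivative_nderiv_on:
  assumes "C_infinity_on S f" "t \<in> S"
  shows "(nderiv_on S k f has_real_derivative nderiv_on S (Suc k) f t) (at t within S)"
  using assms
  by (auto simp: C_infinity_on_def differentiable_on_def has_real_derivative_iff_has_vector_derivative
      vector_derivative_works)

text \<open>This gives uniqueness of derivatives within \<open>{T..}\<close>, the endpoint
  \<open>T\<close> included.\<close>

lemma at_within_Ici_neq_bot: "T \<le> t \<Longrightarrow> at t within {T..} \<noteq> (bot :: real filter)"
  using islimpt_closure_open[of "{T<..}" "{T..}" t] by (simp add: trivial_limit_within)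

text \<open>\<open>vector_derivative\<close> is a chosen value, so it is pinned down by uniqueness
  of the derivative. Agreement with \<open>g\<close> on \<open>{T..}\<close> suffices, since the
  derivative is taken within that set.\<close>

lemma nderiv_on_Suc_eq:
  assumes "\<And>s. s \<ge> T \<Longrightarrow> nderiv_on {T..} k f s = g s"
    and "(g has_real_derivative D) (at t within {T..})" "t \<ge> T"
  shows "nderiv_on {T..} (Suc k) f t = D"
proof -
  have "(nderiv_on {T..} k f has_real_derivative D) (at t within {T..})"
    using has_field_derivative_transform_within[of g D t "{T..}" 1] assms by auto
  then show ?thesis
    using at_within_Ici_neq_bot[OF assms(3)]
    by (simp add: has_real_derivative_iff_has_vector_derivative vector_derivative_within)
qed

lemma nderiv_on_1_eq:
  assumes "(g has_real_derivative D) (at t within {T..})" "t \<ge> T"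
  shows "nderiv_on {T..} 1 g t = D"
  using nderiv_on_Suc_eq[of T 0 g g D t] assms by simp

text \<open>Induction on \<open>k\<close>. Only agreement on \<open>{T..}\<close> can be claimed:
  left of \<open>T\<close> the values of \<open>nderiv_on\<close> are uncontrolled.\<close>

lemma nderiv_on_mem_class:
  assumes "f \<in> P"
    and "\<And>g. g \<in> P \<Longrightarrow> \<exists>g'\<in>P. \<forall>t\<ge>T. (g has_real_derivative g' t) (at t within {T..})"
  shows "\<exists>g\<in>P. \<forall>t\<ge>T. nderiv_on {T..} k f t = g t"
proof (induction k)
  case 0
  then show ?case using assms(1) by auto
next
  case (Suc k)
  then obtain g where g: "g \<in> P" "\<forall>t\<ge>T. nderiv_on {T..} k f t = g t" by blast
  from assms(2)[OF g(1)] obtain g' where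
    g': "g' \<in> P" "\<forall>t\<ge>T. (g has_real_derivative g' t) (at t within {T..})" by blast
  have "nderiv_on {T..} (Suc k) f t = g' t" if "t \<ge> T" for t
    using nderiv_on_Suc_eq[of T k f g "g' t" t] g(2) g'(2) that by blast
  then show ?case using g'(1) by blast
qed

text \<open>Smoothness is reduced to exhibiting a class closed under differentiation, so no formula
  for higher derivatives has to be found.\<close>

lemma C_infinity_on_class:
  assumes "f \<in> P"
    and "\<And>g. g \<in> P \<Longrightarrow> \<exists>g'\<in>P. \<forall>t\<ge>T. (g has_real_derivative g' t) (at t within {T..})"
  shows "C_infinity_on {T..} f"
  unfolding C_infinity_on_def differentiable_on_def
proof (intro allI ballI)
  fix k t assume t: "t \<in> {T..}"
  obtain g where g: "g \<in> P" "\<forall>t\<ge>T. nderiv_on {T..} k f t = g t"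
    using nderiv_on_mem_class[OF assms] by blast
  obtain g' where g': "\<forall>t\<ge>T. (g has_real_derivative g' t) (at t within {T..})"
    using assms(2)[OF g(1)] by blast
  have "(nderiv_on {T..} k f has_real_derivative g' t) (at t within {T..})"
    using has_field_derivative_transform_within[of g "g' t" t "{T..}" 1] g(2) g' t by auto
  then show "nderiv_on {T..} k f differentiable (at t within {T..})"
    by (auto simp: real_differentiable_def)
qed

text \<open>The iterated derivatives depend on the set they are taken within. Those taken within the
  larger half-line form a class closed under differentiation within the smaller one.\<close>

lemma C_infinity_on_Ici_mono:
  assumes "C_infinity_on {M..} f" "M \<le> T"
  shows "C_infinity_on {T..} f"
proof (rule C_infinity_on_class[where P = "range (\<lambda>k. nderiv_on {M..} k f)"])
  show "f \<in> range (\<lambda>k. nderiv_on {M..} k f)"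
    by (rule range_eqI[where x = 0]) simp
  fix g assume "g \<in> range (\<lambda>k. nderiv_on {M..} k f)"
  then obtain k where g: "g = nderiv_on {M..} k f" by blast
  have "(g has_real_derivative nderiv_on {M..} (Suc k) f t) (at t within {T..})" if "t \<ge> T" for t
    unfolding g
    using has_real_derivative_nderiv_on[OF assms(1), of t k] assms(2) that
    by (intro DERIV_subset[of _ _ t "{M..}" "{T..}"]) auto
  then show "\<exists>g'\<in>range (\<lambda>k. nderiv_on {M..} k f).
      \<forall>t\<ge>T. (g has_real_derivative g' t) (at t within {T..})"
    by (intro bexI[of _ "nderiv_on {M..} (Suc k) f"]) (blast | rule rangeI)+
qed

text \<open>These are the real polynomials in the functions of \<open>G\<close>. By the sum and
  product rules, closure under differentiation needs checking on the generators only.\<close>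

inductive_set fun_algebra :: "(real \<Rightarrow> real) set \<Rightarrow> (real \<Rightarrow> real) set" for G where
  gen: "g \<in> G \<Longrightarrow> g \<in> fun_algebra G"
| const: "(\<lambda>_. c) \<in> fun_algebra G"
| add: "g \<in> fun_algebra G \<Longrightarrow> h \<in> fun_algebra G \<Longrightarrow> (\<lambda>t. g t + h t) \<in> fun_algebra G"
| mult: "g \<in> fun_algebra G \<Longrightarrow> h \<in> fun_algebra G \<Longrightarrow> (\<lambda>t. g t * h t) \<in> fun_algebra G"

lemma fun_algebra_derivative:
  assumes "\<And>g. g \<in> G \<Longrightarrow> \<exists>g'\<in>fun_algebra G. \<forall>t\<ge>T. (g has_real_derivative g' t) (at t within {T..})"
    and "g \<in> fun_algebra G"
  shows "\<exists>g'\<in>fun_algebra G. \<forall>t\<ge>T. (g has_real_derivative g' t) (at t within {T..})"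
  using assms(2)
proof induction
  case (gen g)
  then show ?case by (rule assms(1))
next
  case (const c)
  show ?case by (rule bexI[OF _ fun_algebra.const[of 0]]) simp
next
  case (add g h)
  then obtain g' h' where *: "g' \<in> fun_algebra G" "h' \<in> fun_algebra G"
    "\<forall>t\<ge>T. (g has_real_derivative g' t) (at t within {T..})"
    "\<forall>t\<ge>T. (h has_real_derivative h' t) (at t within {T..})" by blast
  show ?case
    by (rule bexI[OF _ fun_algebra.add[OF *(1,2)]]) (use *(3,4) in \<open>auto intro: DERIV_add\<close>)
next
  case (mult g h)
  then obtain g' h' where *: "g' \<in> fun_algebra G" "h' \<in> fun_algebra G"
    "\<forall>t\<ge>T. (g has_real_derivative g' t) (at t within {T..})"
    "\<forall>t\<ge>T. (h has_real_derivative h' t) (at t within {T..})" by blast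
  show ?case
    by (rule bexI[OF _ fun_algebra.add[OF fun_algebra.mult[OF *(1) mult(2)]
              fun_algebra.mult[OF *(2) mult(1)]]])
      (use *(3,4) in \<open>auto intro: DERIV_mult\<close>)
qed

section \<open>The Riccati equation near infinity\<close>

text \<open>At 0 the quotient is 0 because division by zero yields 0, and the bound
  \<open>C * w x\<close> forces the limit there to be 0 as well. Elsewhere it is an ordinary
  quotient of continuous functions.\<close>

lemma continuous_on_average:
  fixes k w :: "real \<Rightarrow> real"
  assumes k: "continuous_on {0..d} k"
    and w: "continuous_on {0..d} w" "w 0 = 0"
    and bd: "\<And>x. x \<in> {0..d} \<Longrightarrow> \<bar>integral {0..x} k / x\<bar> \<le> C * w x"
  shows "continuous_on {0..d} (\<lambda>x. integral {0..x} k / x)"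
  unfolding continuous_on_eq_continuous_within
proof
  fix x assume x: "x \<in> {0..d}"
  show "continuous (at x within {0..d}) (\<lambda>x. integral {0..x} k / x)"
  proof (cases "x = 0")
    case True
    have "((\<lambda>x. C * w x) \<longlongrightarrow> C * w 0) (at 0 within {0..d})"
      using w(1) x True by (intro tendsto_intros) (auto simp: continuous_on_def)
    then have "((\<lambda>x. C * w x) \<longlongrightarrow> 0) (at 0 within {0..d})" by (simp add: w)
    then have "((\<lambda>x. integral {0..x} k / x) \<longlongrightarrow> 0) (at 0 within {0..d})"
      by (rule Lim_null_comparison[rotated])
        (use bd in \<open>auto simp: eventually_at intro!: exI[of _ 1]\<close>)
    then show ?thesis using True by (simp add: continuous_within)
  next
    case False
    have "continuous (at x within {0..d}) (\<lambda>x. integral {0..x} k)"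
      using indefinite_integral_continuous_1[OF integrable_continuous_real[OF k]] x
      by (simp add: continuous_on_eq_continuous_within)
    then show ?thesis using False by (intro continuous_intros) auto
  qed
qed

text \<open>The map sending \<open>h\<close> to the average of \<open>h\<^sup>2 - p\<close> over \<open>{0..x}\<close> contracts the set of
  continuous functions dominated by \<open>2 * K * w\<close>.\<close>

lemma averaged_riccati_fixpoint:
  fixes p w :: "real \<Rightarrow> real"
  assumes d: "0 < d" and K: "0 < K"
    and p: "continuous_on {0..d} p"
    and w: "continuous_on {0..d} w" "w 0 = 0" "mono_on {0..d} w"
    and small: "K * w d \<le> 1 / 8"
    and pw: "\<And>x. x \<in> {0..d} \<Longrightarrow> \<bar>p x\<bar> \<le> K * w x"
  obtains h where "continuous_on {0..d} h"
    and "\<And>x. x \<in> {0..d} \<Longrightarrow> \<bar>h x\<bar> \<le> 2 * K * w x"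
    and "\<And>x. x \<in> {0..d} \<Longrightarrow> x * h x = integral {0..x} (\<lambda>y. (h y)\<^sup>2 - p y)"
proof -
  \<comment> \<open>Bounded continuous functions live on the whole line; composing with the
    retraction \<open>cl\<close> onto \<open>{0..d}\<close> extends functions from the interval to
    it.\<close>
  define cl where "cl = (\<lambda>x::real. max 0 (min x d))"
  have cl: "cl x \<in> {0..d}" for x using d by (auto simp: cl_def)
  have cl_id: "cl x = x" if "x \<in> {0..d}" for x using that by (auto simp: cl_def)
  have cont_cl: "continuous_on UNIV cl" unfolding cl_def by (intro continuous_intros)
  have w_mono: "w y \<le> w x" if "0 \<le> y" "y \<le> x" "x \<le> d" for x y
    using w(3) that by (auto simp: mono_on_def)
  have w0: "0 \<le> w x" if "x \<in> {0..d}" for x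
    using w_mono[of 0 x] that w(2) by auto
  define S where "S = PiC UNIV (\<lambda>x. {- (2 * K * w (cl x)) .. 2 * K * w (cl x)})"
  have S_iff: "h \<in> S \<longleftrightarrow> (\<forall>x. \<bar>apply_bcontfun h x\<bar> \<le> 2 * K * w (cl x))" for h
    by (auto simp: S_def mem_PiC_iff Pi_iff abs_le_iff minus_le_iff)
  have S_le: "\<bar>apply_bcontfun h y\<bar> \<le> 2 * K * w x" if "h \<in> S" "0 \<le> y" "y \<le> x" "x \<le> d" for h x y
  proof -
    have "\<bar>apply_bcontfun h y\<bar> \<le> 2 * K * w (cl y)" using that S_iff by blast
    also have "\<dots> \<le> 2 * K * w x" using that w_mono[of y x] K cl_id[of y] by auto
    finally show ?thesis .
  qed
  define I where "I = (\<lambda>h x. integral {0..x} (\<lambda>y. (apply_bcontfun h y)\<^sup>2 - p y))"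
  have contk: "continuous_on {0..x} (\<lambda>y. (apply_bcontfun h y)\<^sup>2 - p y)" if "x \<le> d" for h x
    by (intro continuous_intros continuous_on_subset[OF p]) (use that in auto)
  \<comment> \<open>The self-map estimate: \<open>K * w x <= 1/8\<close> gives
    \<open>(2 * K * w x)^2 <= K * w x\<close>, and \<open>p\<close> contributes at most another
    \<open>K * w x\<close>. Monotonicity of \<open>w\<close> makes both bounds uniform on
    \<open>{0..x}\<close>.\<close>
  have I_le: "\<bar>I h x / x\<bar> \<le> 2 * K * w x" if h: "h \<in> S" and x: "x \<in> {0..d}" for h x
  proof (cases "x = 0")
    case False
    have "K * w x \<le> K * w d" using w_mono[of x d] x K by (intro mult_left_mono) auto
    then have wx: "0 \<le> w x" "K * w x \<le> 1 / 8" using w0[OF x] small by linarith+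
    have "norm (I h x) \<le> (2 * K * w x) * (x - 0)"
      unfolding I_def
    proof (rule integral_bound)
      show "norm ((apply_bcontfun h t)\<^sup>2 - p t) \<le> 2 * K * w x" if t: "t \<in> {0..x}" for t
      proof -
        have "(apply_bcontfun h t)\<^sup>2 \<le> (2 * K * w x)\<^sup>2"
          using S_le[OF h, of t x] t x by (intro power2_le_iff_abs_le[THEN iffD2]) (use wx K in auto)
        also have "\<dots> = (4 * (K * w x)) * (K * w x)" by (simp add: power2_eq_square)
        also have "\<dots> \<le> 1 * (K * w x)" by (intro mult_right_mono) (use wx K in auto)
        finally have 1: "(apply_bcontfun h t)\<^sup>2 \<le> K * w x" by simp
        have "\<bar>p t\<bar> \<le> K * w t" using pw t x by auto
        also have "\<dots> \<le> K * w x" using w_mono[of t x] t x K by auto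
        finally show ?thesis using 1 zero_le_power2[of "apply_bcontfun h t"]
          unfolding real_norm_def by linarith
      qed
    qed (use x contk in auto)
    then show ?thesis using False x by (auto simp: divide_simps)
  qed (use w in auto)
  define Phi where "Phi = (\<lambda>h. Bcontfun (\<lambda>x. I h (cl x) / cl x))"
  \<comment> \<open>\<open>Bcontfun\<close> is only meaningful on bounded continuous functions, so
    \<open>Phi\<close> is unfolded only for \<open>h\<close> in \<open>S\<close>, where the self-map
    estimate provides both properties.\<close>
  have Phi: "apply_bcontfun (Phi h) = (\<lambda>x. I h (cl x) / cl x)" if h: "h \<in> S" for h
    unfolding Phi_def
  proof (rule Bcontfun_inverse, rule bcontfun_normI)
    have "continuous_on {0..d} (\<lambda>x. I h x / x)"
      unfolding I_def
      by (rule continuous_on_average[OF contk w(1,2), of _ "2 * K"])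
        (use I_le[OF h] in \<open>auto simp: I_def\<close>)
    then show "continuous_on UNIV (\<lambda>x. I h (cl x) / cl x)"
      by (rule continuous_on_compose2[OF _ cont_cl]) (use cl in auto)
    show "norm (I h (cl x) / cl x) \<le> 2 * K * w d" for x
    proof -
      have "\<bar>I h (cl x) / cl x\<bar> \<le> 2 * K * w (cl x)" by (rule I_le[OF h cl])
      also have "\<dots> \<le> 2 * K * w d" using w_mono[of "cl x" d] cl[of x] K by auto
      finally show ?thesis by simp
    qed
  qed
  have "\<exists>!h\<in>S. Phi h = h"
  proof (rule Banach_fix)
    show "complete S"
      unfolding S_def by (intro complete_eq_closed[THEN iffD2] closed_PiC) auto
    have "const_bcontfun 0 \<in> S"
      unfolding S_iff using w0[OF cl] K by (auto simp: const_bcontfun.rep_eq)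
    then show "S \<noteq> {}" by blast
    show "Phi ` S \<subseteq> S"
      using I_le[OF _ cl] by (auto simp: S_iff[of "Phi _"] Phi)
    show "dist (Phi h) (Phi g) \<le> 1 / 2 * dist h g" if h: "h \<in> S" and g: "g \<in> S" for h g
    proof (rule dist_bound)
      fix z
      define x where "x = cl z"
      have x: "x \<in> {0..d}" using cl by (simp add: x_def)
      have "\<bar>I h x / x - I g x / x\<bar> \<le> 1 / 2 * dist h g"
      proof (cases "x = 0")
        case False
        have "I h x - I g x = integral {0..x}
            (\<lambda>y. ((apply_bcontfun h y)\<^sup>2 - p y) - ((apply_bcontfun g y)\<^sup>2 - p y))"
          unfolding I_def
          by (rule integral_diff[symmetric])
            (use x contk in \<open>auto intro!: integrable_continuous_real\<close>)
        also have "norm \<dots> \<le> (1 / 2 * dist h g) * (x - 0)"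
        proof (rule integral_bound)
          show "continuous_on {0..x}
              (\<lambda>y. ((apply_bcontfun h y)\<^sup>2 - p y) - ((apply_bcontfun g y)\<^sup>2 - p y))"
            using x by (intro continuous_on_diff contk) auto
          fix t assume t: "t \<in> {0..x}"
          let ?a = "apply_bcontfun h t" and ?b = "apply_bcontfun g t"
          \<comment> \<open>The source of the contraction factor: the squares differ by
            \<open>(?a + ?b) * (?a - ?b)\<close>, and the first factor is at most
            \<open>4 * K * w d <= 1/2\<close>.\<close>
          have "\<bar>?a + ?b\<bar> \<le> 1 / 2"
          proof -
            have "\<bar>?a\<bar> \<le> 2 * K * w d" "\<bar>?b\<bar> \<le> 2 * K * w d"
              using S_le[OF h, of t d] S_le[OF g, of t d] t x by auto
            then show ?thesis using small by linarith
          qed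
          moreover have "\<bar>?a - ?b\<bar> \<le> dist h g"
            using dist_bounded[of h t g] by (simp add: dist_real_def)
          ultimately have "\<bar>?a + ?b\<bar> * \<bar>?a - ?b\<bar> \<le> 1 / 2 * dist h g"
            by (intro mult_mono) auto
          moreover have "?a\<^sup>2 - p t - (?b\<^sup>2 - p t) = (?a + ?b) * (?a - ?b)"
            by (simp add: power2_eq_square algebra_simps)
          ultimately show "norm (?a\<^sup>2 - p t - (?b\<^sup>2 - p t)) \<le> 1 / 2 * dist h g"
            by (simp add: abs_mult)
        qed (use x in auto)
        finally show ?thesis using False x by (auto simp: divide_simps abs_le_iff)
      qed auto
      then show "dist (apply_bcontfun (Phi h) z) (apply_bcontfun (Phi g) z) \<le> 1 / 2 * dist h g"
        by (simp add: Phi h g dist_real_def x_def)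
    qed
  qed auto
  then obtain h where h: "h \<in> S" "Phi h = h" by blast
  show thesis
  proof (rule that[of "apply_bcontfun h"])
    show "\<bar>apply_bcontfun h x\<bar> \<le> 2 * K * w x" if "x \<in> {0..d}" for x
      using S_le[OF h(1), of x x] that by auto
    show "x * apply_bcontfun h x = integral {0..x} (\<lambda>y. (apply_bcontfun h y)\<^sup>2 - p y)"
      if "x \<in> {0..d}" for x
    proof (cases "x = 0")
      case False
      have "apply_bcontfun h x = I h x / x"
        using fun_cong[OF Phi[OF h(1)], of x] h(2) cl_id[OF that] by simp
      then show ?thesis using False by (simp add: I_def)
    qed auto
  qed auto
qed

text \<open>With \<open>h x = u (1 / x) / x\<close> and \<open>p x = q (1 / x) / x^2\<close>, the
  integral equation for \<open>u\<close> on \<open>[t, \<infinity>)\<close> becomes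
  \<open>x * h x = integral {0..x} (h^2 - p)\<close>, where \<open>x = 1 / t\<close>. The decay of
  \<open>q\<close> becomes \<open>\<bar>p x\<bar> <= K * w x\<close>.\<close>

lemma riccati_solution_at_infinity:
  fixes q :: "real \<Rightarrow> real"
  assumes b: "0 < b" and K: "0 < K" and M: "1 < M"
    and q: "continuous_on {M..} q"
    and q_le: "\<And>t. t \<ge> M \<Longrightarrow> \<bar>q t\<bar> \<le> K / (t\<^sup>2 * ln t powr b)"
  obtains T u where "M \<le> T"
    and "\<And>t. t \<ge> T \<Longrightarrow> (u has_real_derivative q t - (u t)\<^sup>2) (at t within {T..})"
    and "\<And>t. t \<ge> T \<Longrightarrow> \<bar>u t\<bar> \<le> 2 * K / (t * ln t powr b)"
proof -
  \<comment> \<open>The substitution \<open>t = 1 / x\<close> turns the integrals over half-lines into proper ones.\<close>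
  define w where "w = (\<lambda>x::real. if x \<le> 0 then 0 else 1 / ln (1 / x) powr b)"
  define p where "p = (\<lambda>x::real. if x \<le> 0 then 0 else q (1 / x) / x\<^sup>2)"
  \<comment> \<open>This is where \<open>b > 0\<close> enters. It makes the value 0 of
    \<open>w\<close> at the origin the continuous one, and it makes \<open>K * w d\<close> as small
    as the fixed point argument requires for small \<open>d\<close>.\<close>
  have w_lim: "(w \<longlongrightarrow> 0) (at_right 0)"
  proof (rule Lim_transform_eventually)
    show "((\<lambda>x. 1 / ln (1 / x) powr b) \<longlongrightarrow> 0) (at_right 0)"
      using b by real_asymp
    show "\<forall>\<^sub>F x in at_right 0. 1 / ln (1 / x) powr b = w x"
      by (auto simp: eventually_at_filter w_def)
  qed
  then have "((\<lambda>x. K * w x) \<longlongrightarrow> K * 0) (at_right 0)" by (intro tendsto_intros)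
  then have "\<forall>\<^sub>F x in at_right 0. K * w x < 1 / 8"
    by (auto dest: order_tendstoD(2)[of _ _ _ "1 / 8"])
  moreover have "\<forall>\<^sub>F x in at_right 0. x \<in> {0<..<1 / M}"
    using M by (intro eventually_at_right_real) auto
  ultimately have "\<forall>\<^sub>F x in at_right 0. K * w x < 1 / 8 \<and> x \<in> {0<..<1 / M}"
    by eventually_elim auto
  then obtain d where d: "0 < d" "d < 1 / M" "K * w d < 1 / 8"
    using eventually_happens'[OF trivial_limit_at_right_real] by force
  \<comment> \<open>Below 1 the logarithm \<open>ln (1 / x)\<close> is positive, as continuity and
    monotonicity of \<open>w\<close> require.\<close>
  have d1: "d < 1" using d(2) M by (intro less_trans[OF d(2)]) auto
  have inv_ge: "1 / x \<ge> M" if "x \<in> {0<..d}" for x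
  proof -
    have "x * M \<le> 1" using that d(2) M mult_right_mono[of x "1 / M" M] by simp
    then show ?thesis using that by (auto simp: field_simps)
  qed
  have w_cont: "continuous_on {0..d} w"
    unfolding continuous_on_def
  proof
    fix x assume x: "x \<in> {0..d}"
    show "(w \<longlongrightarrow> w x) (at x within {0..d})"
    proof (cases "x = 0")
      case True
      have "at 0 within {0..d} = at_right 0" using d(1) by (rule at_within_Icc_at_right)
      then show ?thesis using w_lim True by (simp add: w_def)
    next
      case False
      have "isCont (\<lambda>x. 1 / ln (1 / x) powr b) x"
        using x False d1 by (intro continuous_intros) (auto simp: field_simps)
      then have "((\<lambda>x. 1 / ln (1 / x) powr b) \<longlongrightarrow> w x) (at x within {0..d})"
        using x False by (auto simp: isCont_def w_def intro: tendsto_within_subset)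
      \<comment> \<open>Points within distance \<open>x\<close> of \<open>x\<close> are positive, so
        the case distinction in \<open>w\<close> disappears near \<open>x\<close>.\<close>
      then show ?thesis
        by (rule Lim_transform_eventually)
          (use x False in \<open>auto simp: eventually_at w_def intro!: exI[of _ x]
             simp: dist_real_def\<close>)
    qed
  qed
  have w_mono: "mono_on {0..d} w"
    by (rule mono_onI)
      (use d1 b in \<open>auto simp: w_def ln_div intro!: divide_left_mono powr_mono2 mult_pos_pos\<close>)
  have p_le: "\<bar>p x\<bar> \<le> K * w x" if "x \<in> {0..d}" for x
  proof (cases "x = 0")
    case False
    then have "\<bar>q (1 / x)\<bar> \<le> K / ((1 / x)\<^sup>2 * ln (1 / x) powr b)"
      using that by (intro q_le inv_ge) auto
    then have "\<bar>q (1 / x)\<bar> / x\<^sup>2 \<le> K / ((1 / x)\<^sup>2 * ln (1 / x) powr b) / x\<^sup>2"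
      by (intro divide_right_mono) auto
    also have "\<dots> = K * w x" using False that by (simp add: w_def field_simps)
    finally show ?thesis using False that by (simp add: p_def abs_divide)
  qed (auto simp: p_def w_def)
  have p_cont: "continuous_on {0..d} p"
    unfolding continuous_on_def
  proof
    fix x assume x: "x \<in> {0..d}"
    show "(p \<longlongrightarrow> p x) (at x within {0..d})"
    proof (cases "x = 0")
      case True
      have "((\<lambda>x. K * w x) \<longlongrightarrow> K * w 0) (at 0 within {0..d})"
        using w_cont x True by (intro tendsto_intros) (auto simp: continuous_on_def)
      then have "((\<lambda>x. K * w x) \<longlongrightarrow> 0) (at 0 within {0..d})" by (simp add: w_def)
      then have "(p \<longlongrightarrow> 0) (at 0 within {0..d})"
        by (rule Lim_null_comparison[rotated])
          (use p_le in \<open>auto simp: eventually_at intro!: exI[of _ 1]\<close>)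
      then show ?thesis using True by (simp add: p_def)
    next
      case False
      have "continuous_on {0<..d} (\<lambda>x. q (1 / x) / x\<^sup>2)"
        using inv_ge by (intro continuous_intros continuous_on_compose2[OF q]) auto
      then have "((\<lambda>x. q (1 / x) / x\<^sup>2) \<longlongrightarrow> p x) (at x within {0<..d})"
        using x False by (auto simp: continuous_on_def p_def)
      moreover have "at x within {0..d} = at x within {0<..d}"
        by (rule at_within_nhd[of _ "{0<..}"]) (use x False in auto)
      ultimately have "((\<lambda>x. q (1 / x) / x\<^sup>2) \<longlongrightarrow> p x) (at x within {0..d})" by simp
      then show ?thesis
        by (rule Lim_transform_eventually)
          (use x False in \<open>auto simp: eventually_at p_def intro!: exI[of _ x]
             simp: dist_real_def\<close>)
    qed
  qed
  obtain h where h: "continuous_on {0..d} h"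
    "\<And>x. x \<in> {0..d} \<Longrightarrow> \<bar>h x\<bar> \<le> 2 * K * w x"
    "\<And>x. x \<in> {0..d} \<Longrightarrow> x * h x = integral {0..x} (\<lambda>y. (h y)\<^sup>2 - p y)"
    using averaged_riccati_fixpoint[OF d(1) K p_cont w_cont _ w_mono _ p_le] d(3)
    by (auto simp: w_def)
  \<comment> \<open>By the fixed point equation \<open>g x = x * h x\<close> on
    \<open>{0..d}\<close>, so \<open>g (1 / t)\<close> is the wanted \<open>u t\<close>. The
    integral form makes its derivative available from the fundamental theorem of calculus.\<close>
  define g where "g = (\<lambda>x. integral {0..x} (\<lambda>y. (h y)\<^sup>2 - p y))"
  define T where "T = 1 / d"
  have T: "M \<le> T" using inv_ge[of d] d by (simp add: T_def)
  have T_inv: "1 / t \<in> {0<..d}" if "t \<ge> T" for t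
  proof -
    have "t > 0" using that T M by linarith
    then show ?thesis using that d(1) by (auto simp: T_def field_simps)
  qed
  have g_h: "g (1 / t) = h (1 / t) / t" if "t \<ge> T" for t
    using h(3)[of "1 / t"] T_inv[OF that] by (simp add: g_def)
  show thesis
  proof (rule that[of T "\<lambda>t. g (1 / t)"])
    show "M \<le> T" by (rule T)
    fix t assume t: "t \<ge> T"
    then have t0: "t > 0" using T M by linarith
    have "(g has_real_derivative (h (1 / t))\<^sup>2 - p (1 / t)) (at (1 / t) within {0..d})"
      unfolding g_def
      by (rule integral_has_real_derivative)
        (use T_inv[OF t] h(1) p_cont in \<open>auto intro!: continuous_intros\<close>)
    then have "(g has_real_derivative (h (1 / t))\<^sup>2 - p (1 / t))
        (at (1 / t) within (\<lambda>t. 1 / t) ` {T..})"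
      by (rule DERIV_subset) (use T_inv in force)
    moreover have "((\<lambda>t. 1 / t) has_real_derivative - 1 / t\<^sup>2) (at t within {T..})"
      using t0 by (auto intro!: derivative_eq_intros simp: power2_eq_square)
    ultimately have "((g \<circ> (\<lambda>t. 1 / t)) has_real_derivative
        ((h (1 / t))\<^sup>2 - p (1 / t)) * (- 1 / t\<^sup>2)) (at t within {T..})"
      by (rule DERIV_image_chain)
    \<comment> \<open>The chain rule factor undoes the scaling:
      \<open>h (1 / t) / t = g (1 / t)\<close> and \<open>p (1 / t) / t^2 = q t\<close>.\<close>
    moreover have "((h (1 / t))\<^sup>2 - p (1 / t)) * (- 1 / t\<^sup>2) = q t - (g (1 / t))\<^sup>2"
      using t0 by (simp add: g_h[OF t] p_def field_simps)
    ultimately show "((\<lambda>t. g (1 / t)) has_real_derivative q t - (g (1 / t))\<^sup>2) (at t within {T..})"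
      by (simp add: o_def)
    have "\<bar>h (1 / t)\<bar> / t \<le> 2 * K * w (1 / t) / t"
      using h(2)[of "1 / t"] T_inv[OF t] t0 by (intro divide_right_mono) auto
    then show "\<bar>g (1 / t)\<bar> \<le> 2 * K / (t * ln t powr b)"
      using t0 by (simp add: g_h[OF t] w_def abs_divide field_simps)
  qed
qed

text \<open>The witness is the exponential of a primitive of \<open>u\<close>. Left of
  \<open>T\<close> the integral runs over an empty interval and the function is 1, so positivity
  holds on the whole line.\<close>

lemma exists_log_primitive:
  fixes u :: "real \<Rightarrow> real"
  assumes "continuous_on {T..} u"
  obtains l where "\<And>t. l t > 0"
    and "\<And>t. t \<ge> T \<Longrightarrow> (l has_real_derivative u t * l t) (at t within {T..})"
proof (rule that[of "\<lambda>t. exp (integral {T..t} u)"])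
  fix t assume t: "t \<ge> T"
  have "((\<lambda>x. integral {T..x} u) has_real_derivative u t) (at t within {T..t + 1})"
    by (rule integral_has_real_derivative)
      (use t in \<open>auto intro: continuous_on_subset[OF assms]\<close>)
  \<comment> \<open>The fundamental theorem is applied on a compact interval; differentiability at
    \<open>t\<close> depends only on a neighbourhood of \<open>t\<close>.\<close>
  moreover have "at t within {T..} = at t within {T..t + 1}"
    by (rule at_within_nhd[of _ "{..<t + 1}"]) auto
  ultimately have "((\<lambda>x. integral {T..x} u) has_real_derivative u t) (at t within {T..})" by simp
  then show "((\<lambda>t. exp (integral {T..t} u)) has_real_derivative u t * exp (integral {T..t} u))
      (at t within {T..})" by (auto intro!: derivative_eq_intros)
qed auto

section \<open>The linear equation\<close>

theorem mainTheorem2: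
  fixes b :: real and f :: "real \<Rightarrow> real"
  assumes "b > 2 / 3" and "f \<in> F_class b"
  shows "\<exists>T>50. \<exists>C I lam. one_parameter_family I T lam \<and>
    (\<forall>c\<in>I. lam c \<in> Lambda_class b \<and> C_infinity_on {T..} (lam c) \<and>
       solves_ode_on T f (lam c) \<and> slow_positive_on b C T (lam c))"
proof -
  obtain M where M: "M > 50" and smooth_M: "C_infinity_on {M..} f"
    and "\<forall>k. \<exists>C>0. \<forall>t\<ge>M. \<bar>nderiv_on {M..} k f t\<bar> \<le> C / (t ^ k * ln t powr b)"
    using assms(2) by (auto simp: F_class_def)
  then obtain K where K: "K > 0"
    and K_le: "\<forall>t\<ge>M. \<bar>nderiv_on {M..} 1 f t\<bar> \<le> K / (t ^ 1 * ln t powr b)"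
    by meson
  define q where "q = (\<lambda>t. nderiv_on {M..} 1 f t / t)"
  have "continuous_on {M..} (nderiv_on {M..} 1 f)"
    using smooth_M unfolding C_infinity_on_def by (blast intro: differentiable_imp_continuous_on)
  then have "continuous_on {M..} q"
    unfolding q_def using M by (intro continuous_intros) auto
  \<comment> \<open>Dividing the bound on the first derivative of \<open>f\<close> by
    \<open>t\<close> gives the quadratic decay that the Riccati lemma asks for.\<close>
  moreover have "\<bar>q t\<bar> \<le> K / (t\<^sup>2 * ln t powr b)" if "t \<ge> M" for t
  proof -
    have "\<bar>q t\<bar> \<le> K / (t ^ 1 * ln t powr b) / t"
      using divide_right_mono[OF K_le[rule_format, OF that], of t] that M
      by (simp only: q_def abs_divide abs_of_pos)
    then show ?thesis by (simp add: power2_eq_square mult_ac)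
  qed
  ultimately obtain T u where T: "M \<le> T"
    and u: "\<And>t. t \<ge> T \<Longrightarrow> (u has_real_derivative q t - (u t)\<^sup>2) (at t within {T..})"
    and u_le: "\<And>t. t \<ge> T \<Longrightarrow> \<bar>u t\<bar> \<le> 2 * K / (t * ln t powr b)"
    using riccati_solution_at_infinity[of b K M q] assms(1) K M by auto
  have "continuous_on {T..} u"
    using u by (intro DERIV_continuous_on) auto
  then obtain l where l_pos: "\<And>t. l t > 0"
    and l: "\<And>t. t \<ge> T \<Longrightarrow> (l has_real_derivative u t * l t) (at t within {T..})"
    using exists_log_primitive by blast
  have T50: "T > 50" using T M by linarith
  have smooth_f: "C_infinity_on {T..} f" by (rule C_infinity_on_Ici_mono[OF smooth_M T])
  \<comment> \<open>\<open>q\<close> was built from the derivative within \<open>{M..}\<close>,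
    whereas the equation refers to the one within \<open>{T..}\<close>; they agree on
    \<open>{T..}\<close>, the endpoint included.\<close>
  have q_eq: "q t = nderiv_on {T..} 1 f t / t" if "t \<ge> T" for t
  proof -
    have "(f has_real_derivative nderiv_on {M..} 1 f t) (at t within {T..})"
      using has_real_derivative_nderiv_on[OF smooth_M, of t 0] that T
      by (intro DERIV_subset[of _ _ t "{M..}" "{T..}"]) auto
    from nderiv_on_1_eq[OF this that] show ?thesis by (simp add: q_def)
  qed

  \<comment> \<open>On \<open>{T..}\<close> the derivatives of the last three generators are
    \<open>- inverse^2\<close>, \<open>f' * inverse - u^2\<close> and \<open>u * l\<close>, all
    polynomials in the generators.\<close>
  define G where "G = range (\<lambda>k. nderiv_on {T..} k f) \<union> {inverse, u, l}"
  have f_in: "nderiv_on {T..} k f \<in> fun_algebra G" for k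
    by (rule fun_algebra.gen) (auto simp: G_def)
  have inv_in: "inverse \<in> fun_algebra G" and u_in: "u \<in> fun_algebra G" and l_in: "l \<in> fun_algebra G"
    by (auto intro!: fun_algebra.gen simp: G_def)
  have G_deriv: "\<exists>g'\<in>fun_algebra G. \<forall>t\<ge>T. (g has_real_derivative g' t) (at t within {T..})"
    if "g \<in> G" for g
    using that[unfolded G_def Un_iff]
  proof (elim disjE insertE emptyE)
    assume "g \<in> range (\<lambda>k. nderiv_on {T..} k f)"
    then obtain k where "g = nderiv_on {T..} k f" by (rule rangeE)
    then show ?thesis
      using has_real_derivative_nderiv_on[OF smooth_f, of _ k] f_in[of "Suc k"]
      by (intro bexI[of _ "nderiv_on {T..} (Suc k) f"]) auto
  next
    assume "g = inverse"
    then show ?thesis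
      using T50 by (intro bexI[OF _ fun_algebra.mult[OF fun_algebra.const[of "-1"]
            fun_algebra.mult[OF inv_in inv_in]]]) (auto intro!: derivative_eq_intros)
  next
    assume "g = u"
    then show ?thesis
      using u q_eq
      by (intro bexI[OF _ fun_algebra.add[OF fun_algebra.mult[OF f_in[of 1] inv_in]
            fun_algebra.mult[OF fun_algebra.const[of "-1"] fun_algebra.mult[OF u_in u_in]]]])
        (auto simp: power2_eq_square divide_inverse)
  next
    assume "g = l"
    then show ?thesis
      using l by (intro bexI[OF _ fun_algebra.mult[OF u_in l_in]]) auto
  qed

  \<comment> \<open>Scaling by \<open>c\<close> leaves the logarithmic derivative \<open>u\<close>
    unchanged, so the single constant \<open>2 * K\<close> serves the whole family.\<close>
  define lam where "lam = (\<lambda>c t. c * l t)"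
  have lam': "(lam c has_real_derivative c * (u t * l t)) (at t within {T..})" if "t \<ge> T" for c t
    unfolding lam_def using l[OF that] by (rule DERIV_cmult)
  have lam_1: "nderiv_on {T..} 1 (lam c) t = c * (u t * l t)" if "t \<ge> T" for c t
    using nderiv_on_1_eq[OF lam' that] that by blast
  have lam_2: "nderiv_on {T..} 2 (lam c) t = c * (q t * l t)" if t: "t \<ge> T" for c t
    unfolding numeral_2_eq_2
  proof (rule nderiv_on_Suc_eq[OF _ _ t])
    show "nderiv_on {T..} (Suc 0) (lam c) s = c * (u s * l s)" if "s \<ge> T" for s
      using lam_1[OF that] by simp
    \<comment> \<open>Here the Riccati equation becomes the linear one:
      \<open>(u * l)' = (q - u^2) * l + u * (u * l) = q * l\<close>.\<close>
    show "((\<lambda>s. c * (u s * l s)) has_real_derivative c * (q t * l t)) (at t within {T..})"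
      by (rule derivative_eq_intros u[OF t] l[OF t] refl)+ (simp add: power2_eq_square algebra_simps)
  qed

  have family: "one_parameter_family {0<..} T lam"
    unfolding one_parameter_family_def
  proof (intro conjI ballI impI)
    have "continuous_on {T..} l" using l by (intro DERIV_continuous_on) auto
    then show "continuous_on ({0<..} \<times> {T..}) (\<lambda>(c, t). lam c t)"
      unfolding lam_def case_prod_beta
      by (intro continuous_intros continuous_on_compose2[of "{T..}" l _ snd]) auto
    \<comment> \<open>Distinct multiples already differ at \<open>t = T\<close>, since
      \<open>l T\<close> is positive.\<close>
    show "\<exists>t\<ge>T. lam c t \<noteq> lam d t" if "c \<noteq> d" for c d
      using that l_pos[of T] by (intro exI[of _ T]) (auto simp: lam_def)
    show "{0::real<..} \<noteq> {}" by (auto intro: exI[of _ 1])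
  qed (auto simp: is_interval_1)

  have "lam c \<in> Lambda_class b \<and> C_infinity_on {T..} (lam c) \<and>
      solves_ode_on T f (lam c) \<and> slow_positive_on b (2 * K) T (lam c)" if c: "c > 0" for c
  proof -
    have lam_pos: "lam c t > 0" for t using c l_pos by (simp add: lam_def)
    have "C_infinity_on {T..} (lam c)"
      unfolding lam_def
      by (rule C_infinity_on_class[OF fun_algebra.mult[OF fun_algebra.const l_in]
            fun_algebra_derivative[OF G_deriv]])
    moreover have "solves_ode_on T f (lam c)"
      unfolding solves_ode_on_def
    proof (intro conjI allI impI smooth_f)
      fix t assume t: "t \<ge> T"
      show "nderiv_on {T..} 2 (lam c) t / lam c t = nderiv_on {T..} 1 f t / t"
        unfolding lam_2[OF t] q_eq[OF t, symmetric] using c l_pos[of t] by (simp add: lam_def)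
    qed
    moreover have "slow_positive_on b (2 * K) T (lam c)"
      unfolding slow_positive_on_def
    proof (intro allI impI conjI)
      fix t assume t: "t \<ge> T"
      show "lam c t > 0" by (rule lam_pos)
      show "\<bar>nderiv_on {T..} 1 (lam c) t\<bar> / lam c t \<le> 2 * K / (t * ln t powr b)"
        unfolding lam_1[OF t] using u_le[OF t] c l_pos[of t]
        by (simp add: lam_def abs_mult)
    qed
    ultimately show ?thesis
      using T50 assms(2) unfolding Lambda_class_def by blast
  qed
  then show ?thesis using T50 family
    by (intro exI[of _ T] conjI exI[of _ "2 * K"] exI[of _ "{0<..}"] exI[of _ lam]) auto
qed

end
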